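(* Let $\Omega\subset\mathbb R^m$ be open, $f\in L^2_{loc}(\Omega)^n$, $x_0\in\Omega$, $\nu_0\in\mathbb S^{m-1}$. Then $$j_{f,\nu_0}(x_0)^2\le4\limsup_{\tau\to0^+}\frac1{|Q_\tau(x_0,\nu_0)|}\int_{Q_\tau(x_0,\nu_0)}\Big|f-\frac1{|Q_\tau(x_0,\nu_0)|}\int_{Q_\tau(x_0,\nu_0)}f\Big|^2.$$ In particular, if $x_0$ is a $2$-Lebesgue point of $f$, then $j_f(x_0)=0$. If $f\in L^\infty_{loc}(\Omega)^n$, then $J_f\subset\widetilde J_f\subset S_f$. Moreover, in this case, for every $x_0\in J_f$, $$j_f(x_0)=j_{f,\nu_f(x_0)}(x_0)=|f^+-f^-|(x_0).$$
   Context: For $x\in\mathbb R^m$, $\nu\in\mathbb S^{m-1}$, $r>0$: $B_r^\pm(x,\nu)=\{y\in B_r(x):\pm\nu\cdot(y-x)\ge0\}$; $B^{m-1}_r(x,\nu)=B_r(x)\cap(x+\nu^\perp)$; $Q_r(x,\nu)=B_r^{m-1}(x,\nu)+(-r,r)\,\nu$; $Q_r^-(x,\nu)=B^{m-1}_r(x,\nu)+(-r,0]\,\nu$. $j_{f,\nu_0}(x_0)\ge0$ is defined by $$j_{f,\nu_0}(x_0)^2=\limsup_{\tau\to0^+}\frac1{|Q_\tau^-(x_0,\nu_0)|}\int_{Q_\tau^-(x_0,\nu_0)}|f(x+\tau\nu_0)-f(x)|^2\,dx,$$ $j_f(x_0)=\sup_{\nu_0\in\mathbb S^{m-1}}j_{f,\nu_0}(x_0)$,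 and $\widetilde J_f=\{x_0\in\Omega:j_f(x_0)>0\}$. $x_0$ is a $2$-Lebesgue point of $f$ if $\lim_{r\to0^+}\frac1{|B_r(x_0)|}\int_{B_r(x_0)}|f(y)-f(x_0)|^2\,dy=0$. $S_f$ is the set of $x\in\Omega$ for which there is no $z\in\mathbb R^n$ with $\lim_{r\to0^+}\frac1{|B_r(x)|}\int_{B_r(x)}|f(y)-z|\,dy=0$. $J_f$ is the set of $x\in\Omega$ for which there are $\nu_f\in\mathbb S^{m-1}$ and $f^+\ne f^-$ in $\mathbb R^n$ with $\lim_{r\to0^+}\frac1{|B_r^\pm(x,\nu_f)|}\int_{B_r^\pm(x,\nu_f)}|f(y)-f^\pm|\,dy=0$; the triple $(f^+,f^-,\nu_f)$ is unique up to exchanging $f^\pm$ and changing the sign of $\nu_f$ (the assertion holds for either choice). *)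

theory Defs
  imports "HOL-Analysis.Analysis"
begin

text \<open>
  Functions on an open set \<open>\<Omega>\<close> are represented by total functions whose values outside
  \<open>\<Omega>\<close> are irrelevant: every notion below at a point of \<open>\<Omega>\<close> is a limit as the radius
  tends to 0 from the right. Averages of nonnegative quantities and their upper limits
  are taken in \<open>[0, \<infinity>]\<close>, since for locally square integrable \<open>f\<close> the upper limits may be infinite.
\<close>

definition half_ball :: "'a::real_inner \<Rightarrow> 'a \<Rightarrow> real \<Rightarrow> 'a set" where
  "half_ball x \<nu> r = {y \<in> ball x r. \<nu> \<bullet> (y - x) \<ge> 0}"

definition disc :: "'a::real_inner \<Rightarrow> 'a \<Rightarrow> real \<Rightarrow> 'a set" where
  "disc x \<nu> r = ball x r \<inter> {x + v |v. \<nu> \<bullet> v = 0}"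

definition cyl :: "'a::real_inner \<Rightarrow> 'a \<Rightarrow> real \<Rightarrow> 'a set" where
  "cyl x \<nu> r = {y + t *\<^sub>R \<nu> |y t. y \<in> disc x \<nu> r \<and> t \<in> {-r<..<r}}"

definition lower_cyl :: "'a::real_inner \<Rightarrow> 'a \<Rightarrow> real \<Rightarrow> 'a set" where
  "lower_cyl x \<nu> r = {y + t *\<^sub>R \<nu> |y t. y \<in> disc x \<nu> r \<and> t \<in> {-r<..0}}"

definition nn_avg :: "'a::euclidean_space set \<Rightarrow> ('a \<Rightarrow> ennreal) \<Rightarrow> ennreal" where
  "nn_avg A g = (\<integral>\<^sup>+x\<in>A. g x \<partial>lebesgue) / emeasure lebesgue A"

definition avg :: "'a::euclidean_space set \<Rightarrow> ('a \<Rightarrow> 'b::euclidean_space) \<Rightarrow> 'b" where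
  "avg A f = (1 / measure lebesgue A) *\<^sub>R (LINT x:A|lebesgue. f x)"

definition L2_loc :: "'a::euclidean_space set \<Rightarrow> ('a \<Rightarrow> 'b::euclidean_space) set" where
  "L2_loc \<Omega> = {f. f \<in> borel_measurable (lebesgue_on \<Omega>) \<and>
     (\<forall>K. compact K \<and> K \<subseteq> \<Omega> \<longrightarrow> (\<integral>\<^sup>+x\<in>K. ennreal ((norm (f x))\<^sup>2) \<partial>lebesgue) < \<infinity>)}"

definition Linf_loc :: "'a::euclidean_space set \<Rightarrow> ('a \<Rightarrow> 'b::euclidean_space) set" where
  "Linf_loc \<Omega> = {f. f \<in> borel_measurable (lebesgue_on \<Omega>) \<and>
     (\<forall>K. compact K \<and> K \<subseteq> \<Omega> \<longrightarrow> (\<exists>C. AE x in lebesgue. x \<in> K \<longrightarrow> norm (f x) \<le> C))}"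

definition ennsqrt :: "ennreal \<Rightarrow> ennreal" where
  "ennsqrt a = (if a = \<infinity> then \<infinity> else ennreal (sqrt (enn2real a)))"

lemma ennsqrt_power2: "(ennsqrt a)\<^sup>2 = a"
  by (cases a) (auto simp: ennsqrt_def ennreal_power)

definition jdir :: "('a::euclidean_space \<Rightarrow> 'b::euclidean_space) \<Rightarrow> 'a \<Rightarrow> 'a \<Rightarrow> ennreal" where
  "jdir f \<nu> x0 = ennsqrt (Limsup (at_right 0)
     (\<lambda>\<tau>. nn_avg (lower_cyl x0 \<nu> \<tau>) (\<lambda>x. ennreal ((norm (f (x + \<tau> *\<^sub>R \<nu>) - f x))\<^sup>2))))"

definition jsup :: "('a::euclidean_space \<Rightarrow> 'b::euclidean_space) \<Rightarrow> 'a \<Rightarrow> ennreal" where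
  "jsup f x0 = (SUP \<nu>\<in>sphere 0 1. jdir f \<nu> x0)"

definition J_tilde :: "'a::euclidean_space set \<Rightarrow> ('a \<Rightarrow> 'b::euclidean_space) \<Rightarrow> 'a set" where
  "J_tilde \<Omega> f = {x0 \<in> \<Omega>. jsup f x0 > 0}"

definition Lebesgue_point2 :: "('a::euclidean_space \<Rightarrow> 'b::euclidean_space) \<Rightarrow> 'a \<Rightarrow> bool" where
  "Lebesgue_point2 f x0 \<longleftrightarrow>
     ((\<lambda>r. nn_avg (ball x0 r) (\<lambda>y. ennreal ((norm (f y - f x0))\<^sup>2))) \<longlongrightarrow> 0) (at_right 0)"

definition S_set :: "'a::euclidean_space set \<Rightarrow> ('a \<Rightarrow> 'b::euclidean_space) \<Rightarrow> 'a set" where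
  "S_set \<Omega> f = {x \<in> \<Omega>. \<not> (\<exists>z.
     ((\<lambda>r. nn_avg (ball x r) (\<lambda>y. ennreal (norm (f y - z)))) \<longlongrightarrow> 0) (at_right 0))}"

text \<open>The half ball \<open>B\<^sup>-\<close> with respect to \<open>\<nu>\<close> is the half ball with respect to \<open>-\<nu>\<close>.\<close>

definition jump_triple ::
  "('a::euclidean_space \<Rightarrow> 'b::euclidean_space) \<Rightarrow> 'a \<Rightarrow> 'b \<Rightarrow> 'b \<Rightarrow> 'a \<Rightarrow> bool" where
  "jump_triple f x fp fm \<nu> \<longleftrightarrow> \<nu> \<in> sphere 0 1 \<and> fp \<noteq> fm \<and>
     ((\<lambda>r. nn_avg (half_ball x \<nu> r) (\<lambda>y. ennreal (norm (f y - fp)))) \<longlongrightarrow> 0) (at_right 0) \<and>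
     ((\<lambda>r. nn_avg (half_ball x (-\<nu>) r) (\<lambda>y. ennreal (norm (f y - fm)))) \<longlongrightarrow> 0) (at_right 0)"

definition J_set :: "'a::euclidean_space set \<Rightarrow> ('a \<Rightarrow> 'b::euclidean_space) \<Rightarrow> 'a set" where
  "J_set \<Omega> f = {x \<in> \<Omega>. \<exists>fp fm \<nu>. jump_triple f x fp fm \<nu>}"

end

theory Submission
  imports Defs
begin

text \<open>
  Everything rests on one geometric fact. The shift by \<open>\<tau> \<nu>\<close> maps the lower cylinder
  \<open>Q\<^sup>-\<close> onto the upper half of the cylinder \<open>Q\<close>, up to the top disc, which is a null
  set. Hence the integral over \<open>Q\<^sup>-\<close> of \<open>h (x + \<tau> \<nu>) + h x\<close> is the integral of \<open>h\<close> over
  \<open>Q\<close>, and \<open>Q\<close> has twice the measure of \<open>Q\<^sup>-\<close>. So a pointwise estimate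
  \<open>u x \<le> p x + K (h (x + \<tau> \<nu>) + h x)\<close> becomes an estimate of averages with the
  error \<open>2 K\<close> times the average of \<open>h\<close> over \<open>Q\<close> (\<open>nn_avg_lower_cyl_le\<close>).
  Each claim follows from a choice of \<open>u\<close>, \<open>p\<close>, \<open>h\<close> and \<open>K\<close>.

  For the oscillation bound, take \<open>u\<close> to be the squared increment
  \<open>|f(x + \<tau> \<nu>) - f x|\<^sup>2\<close>, \<open>p = 0\<close>, \<open>h = |f - c|\<^sup>2\<close> and \<open>K = 2\<close>; this gives the factor 4
  for every choice of constants \<open>c\<close>, in particular for the mean over \<open>Q\<close>. If \<open>c\<close> is the
  value of \<open>f\<close> at a 2-Lebesgue point, the right-hand side tends to 0, because \<open>Q\<close> lies in
  the ball of twice the radius, whose measure is at most \<open>2\<^sup>m\<close> times that of \<open>Q\<close>.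

  For locally bounded \<open>f\<close>, compare \<open>f\<close> with the function \<open>w\<close> that equals \<open>a\<close> on one
  side of a hyperplane through \<open>x0\<close> and \<open>b\<close> on the other. Squares of bounded quantities
  are Lipschitz, so the squared increments of \<open>f\<close> and of \<open>w\<close> differ by a multiple of
  \<open>h (x + \<tau> \<nu>) + h x\<close> with \<open>h = |f - w|\<close>, whose average vanishes in the limit by the
  \<open>L\<^sup>1\<close> convergence. The increments of \<open>w\<close> have norm at most \<open>|a - b|\<close> in every direction and
  exactly \<open>|a - b|\<close> on \<open>Q\<^sup>-\<close> in the direction normal to the hyperplane; this gives the value of
  \<open>j\<close> at a jump point (\<open>jdir_le_two_phase\<close>, \<open>jdir_ge_two_phase\<close>). The
  case \<open>a = b\<close> shows that \<open>j\<close> vanishes off \<open>S_f\<close>.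
\<close>

section \<open>Translations of Lebesgue measure\<close>

lemma lebesgue_measurable_shift:
  fixes a :: "'a::euclidean_space"
  shows "(\<lambda>x. x + a) \<in> lebesgue \<rightarrow>\<^sub>M lebesgue"
  using lebesgue_affine_measurable[of "\<lambda>_. 1" a] by (simp add: euclidean_representation add.commute)

lemma distr_lebesgue_shift:
  fixes a :: "'a::euclidean_space"
  shows "distr lebesgue lebesgue (\<lambda>x. x + a) = lebesgue"
  using lebesgue_affine_euclidean[of "\<lambda>_. 1" a, symmetric]
  by (simp add: euclidean_representation add.commute density_1)

lemma nn_integral_lebesgue_shift:
  fixes a :: "'a::euclidean_space"
  assumes "h \<in> borel_measurable lebesgue"
  shows "(\<integral>\<^sup>+x. h (x + a) \<partial>lebesgue) = (\<integral>\<^sup>+x. h x \<partial>lebesgue)"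
  using nn_integral_distr[OF lebesgue_measurable_shift[of a], of h] assms
  by (simp add: distr_lebesgue_shift)

lemma AE_lebesgue_shift:
  fixes a :: "'a::euclidean_space"
  assumes "AE x in lebesgue. P x"
  shows "AE x in lebesgue. P (x + a)"
proof (rule AE_distrD[OF lebesgue_measurable_shift])
  show "AE x in distr lebesgue lebesgue (\<lambda>x. x + a). P x"
    unfolding distr_lebesgue_shift by (rule assms)
qed

lemma AE_not_in_hyperplane:
  fixes \<nu> :: "'a::euclidean_space"
  assumes "\<nu> \<noteq> 0"
  shows "AE x in lebesgue. \<nu> \<bullet> x \<noteq> c"
proof -
  have "{x. \<nu> \<bullet> x = c} \<in> null_sets lebesgue"
    using negligible_hyperplane[of \<nu> c] assms by (simp add: negligible_iff_null_sets)
  from AE_not_in[OF this] show ?thesis by simp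
qed

section \<open>Geometry of the cylinders\<close>

text \<open>
  Splitting \<open>z - x\<close> into its component along \<open>\<nu>\<close> and the orthogonal rest turns the
  parametrised cylinders into sets cut out by inequalities, which is the form needed for
  measurability and for shifts along \<open>\<nu>\<close>.
\<close>

lemma mem_slab_iff:
  fixes \<nu> :: "'a::real_inner"
  assumes "norm \<nu> = 1"
  shows "(\<exists>y t. z = y + t *\<^sub>R \<nu> \<and> y \<in> disc x \<nu> r \<and> t \<in> T) \<longleftrightarrow>
    norm (z - x - (\<nu> \<bullet> (z - x)) *\<^sub>R \<nu>) < r \<and> \<nu> \<bullet> (z - x) \<in> T" (is "?L \<longleftrightarrow> ?R")
proof
  have nn: "\<nu> \<bullet> \<nu> = 1" using assms by (simp add: norm_eq_1)
  {
    assume ?L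
    then obtain v t where *: "z = x + v + t *\<^sub>R \<nu>" "norm v < r" "\<nu> \<bullet> v = 0" "t \<in> T"
      by (auto simp: disc_def dist_norm)
    then have "\<nu> \<bullet> (z - x) = t" by (simp add: nn inner_add_right algebra_simps)
    then show ?R using * by simp
  }
  assume R: ?R
  let ?t = "\<nu> \<bullet> (z - x)"
  have "z = (x + (z - x - ?t *\<^sub>R \<nu>)) + ?t *\<^sub>R \<nu>" by simp
  moreover have "\<nu> \<bullet> (z - x - ?t *\<^sub>R \<nu>) = 0" by (simp add: nn inner_diff_right)
  ultimately have "x + (z - x - ?t *\<^sub>R \<nu>) \<in> disc x \<nu> r"
    using R unfolding disc_def mem_ball dist_norm Int_iff mem_Collect_eq
    by (metis add_diff_cancel_left' norm_minus_commute)
  with R show ?L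
    by (intro exI[of _ "x + (z - x - ?t *\<^sub>R \<nu>)"] exI[of _ ?t]) simp
qed

lemma mem_cyl_iff:
  fixes \<nu> :: "'a::real_inner"
  assumes "norm \<nu> = 1"
  shows "z \<in> cyl x \<nu> r \<longleftrightarrow>
    norm (z - x - (\<nu> \<bullet> (z - x)) *\<^sub>R \<nu>) < r \<and> -r < \<nu> \<bullet> (z - x) \<and> \<nu> \<bullet> (z - x) < r"
  using mem_slab_iff[OF assms, of z x r "{-r<..<r}"] unfolding cyl_def by simp

lemma mem_lower_cyl_iff:
  fixes \<nu> :: "'a::real_inner"
  assumes "norm \<nu> = 1"
  shows "z \<in> lower_cyl x \<nu> r \<longleftrightarrow>
    norm (z - x - (\<nu> \<bullet> (z - x)) *\<^sub>R \<nu>) < r \<and> -r < \<nu> \<bullet> (z - x) \<and> \<nu> \<bullet> (z - x) \<le> 0"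
  using mem_slab_iff[OF assms, of z x r "{-r<..0}"] unfolding lower_cyl_def by simp

lemma norm_split_unit:
  fixes \<nu> :: "'a::real_inner"
  assumes "norm \<nu> = 1"
  shows "(norm v)\<^sup>2 = (norm (v - (\<nu> \<bullet> v) *\<^sub>R \<nu>))\<^sup>2 + (\<nu> \<bullet> v)\<^sup>2"
proof -
  have nn: "\<nu> \<bullet> \<nu> = 1" using assms by (simp add: norm_eq_1)
  show ?thesis
    by (simp only: power2_norm_eq_inner)
      (simp add: inner_diff_left inner_diff_right nn inner_commute power2_eq_square)
qed

lemma ball_subset_cyl:
  fixes \<nu> :: "'a::real_inner"
  assumes "norm \<nu> = 1"
  shows "ball x r \<subseteq> cyl x \<nu> r"
proof
  fix z assume "z \<in> ball x r"
  then have z: "norm (z - x) < r" by (simp add: dist_norm norm_minus_commute)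
  have "norm (z - x - (\<nu> \<bullet> (z - x)) *\<^sub>R \<nu>) \<le> norm (z - x)"
    using norm_split_unit[OF assms, of "z - x"] by (intro power2_le_imp_le[OF _ norm_ge_zero]) auto
  moreover have "\<bar>\<nu> \<bullet> (z - x)\<bar> \<le> norm (z - x)"
    using Cauchy_Schwarz_ineq2[of \<nu> "z - x"] assms by simp
  ultimately show "z \<in> cyl x \<nu> r" using z by (auto simp: mem_cyl_iff[OF assms])
qed

text \<open>
  The height may equal \<open>r\<close>: the shift by \<open>r \<nu>\<close> moves the base of the lower cylinder to
  the top disc, which is not part of the open cylinder.
\<close>

lemma closed_cyl_subset_ball:
  fixes \<nu> :: "'a::real_inner"
  assumes "norm \<nu> = 1" "norm (z - x - (\<nu> \<bullet> (z - x)) *\<^sub>R \<nu>) < r" "\<bar>\<nu> \<bullet> (z - x)\<bar> \<le> r"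
  shows "z \<in> ball x (2 * r)"
proof -
  have "norm (z - x) \<le> norm (z - x - (\<nu> \<bullet> (z - x)) *\<^sub>R \<nu>) + norm ((\<nu> \<bullet> (z - x)) *\<^sub>R \<nu>)"
    by (metis diff_add_cancel norm_triangle_ineq)
  also have "\<dots> < 2 * r" using assms by simp
  finally show ?thesis by (simp add: dist_norm norm_minus_commute)
qed

lemma cyl_subset_ball:
  fixes \<nu> :: "'a::real_inner"
  assumes "norm \<nu> = 1"
  shows "cyl x \<nu> r \<subseteq> ball x (2 * r)"
  using closed_cyl_subset_ball[OF assms] by (auto simp: mem_cyl_iff[OF assms])

lemma lower_cyl_subset_cyl: "lower_cyl x \<nu> r \<subseteq> cyl x \<nu> r"
proof
  fix z assume "z \<in> lower_cyl x \<nu> r"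
  then obtain y t where *: "z = y + t *\<^sub>R \<nu>" "y \<in> disc x \<nu> r" "-r < t" "t \<le> 0"
    by (auto simp: lower_cyl_def)
  then have "t < r" by simp
  then show "z \<in> cyl x \<nu> r" using * by (auto simp: cyl_def intro!: exI[of _ y] exI[of _ t])
qed

lemma shift_lower_cyl_subset_ball:
  fixes \<nu> :: "'a::real_inner"
  assumes "norm \<nu> = 1" "z \<in> lower_cyl x \<nu> r"
  shows "z + r *\<^sub>R \<nu> \<in> ball x (2 * r)"
proof (rule closed_cyl_subset_ball[OF assms(1)])
  have nn: "\<nu> \<bullet> \<nu> = 1" using assms by (simp add: norm_eq_1)
  have e: "\<nu> \<bullet> (z + r *\<^sub>R \<nu> - x) = \<nu> \<bullet> (z - x) + r" by (simp add: nn inner_diff_right inner_add_right)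
  show "\<bar>\<nu> \<bullet> (z + r *\<^sub>R \<nu> - x)\<bar> \<le> r"
    unfolding e using assms by (simp add: mem_lower_cyl_iff)
  show "norm (z + r *\<^sub>R \<nu> - x - (\<nu> \<bullet> (z + r *\<^sub>R \<nu> - x)) *\<^sub>R \<nu>) < r"
    unfolding e using assms by (simp add: mem_lower_cyl_iff algebra_simps)
qed

lemma sets_cyl:
  fixes \<nu> :: "'a::euclidean_space"
  assumes "norm \<nu> = 1"
  shows "cyl x \<nu> r \<in> sets lebesgue" "lower_cyl x \<nu> r \<in> sets lebesgue"
proof -
  have "cyl x \<nu> r = {z. norm (z - x - (\<nu> \<bullet> (z - x)) *\<^sub>R \<nu>) < r \<and> -r < \<nu> \<bullet> (z - x) \<and> \<nu> \<bullet> (z - x) < r}"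
    using mem_cyl_iff[OF assms] by blast
  also have "\<dots> \<in> sets borel" by measurable
  finally show "cyl x \<nu> r \<in> sets lebesgue" by simp
  have "lower_cyl x \<nu> r = {z. norm (z - x - (\<nu> \<bullet> (z - x)) *\<^sub>R \<nu>) < r \<and> -r < \<nu> \<bullet> (z - x) \<and> \<nu> \<bullet> (z - x) \<le> 0}"
    using mem_lower_cyl_iff[OF assms] by blast
  also have "\<dots> \<in> sets borel" by measurable
  finally show "lower_cyl x \<nu> r \<in> sets lebesgue" by simp
qed

section \<open>Averages over lower cylinders\<close>

text \<open>
  The lower cylinder and its shift by \<open>r \<nu>\<close> tile the cylinder. The shift also contains
  the points of height exactly \<open>r\<close>, which lie in a hyperplane and have measure 0.
\<close>

lemma nn_integral_lower_cyl_shift_add: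
  fixes \<nu> :: "'a::euclidean_space"
  assumes \<nu>: "norm \<nu> = 1" and "0 < r" and [measurable]: "h \<in> borel_measurable lebesgue"
  shows "(\<integral>\<^sup>+z\<in>lower_cyl x \<nu> r. (h (z + r *\<^sub>R \<nu>) + h z) \<partial>lebesgue) = (\<integral>\<^sup>+z\<in>cyl x \<nu> r. h z \<partial>lebesgue)"
proof -
  note [measurable] = sets_cyl[OF \<nu>]
  have nn: "\<nu> \<bullet> \<nu> = 1" using \<nu> by (simp add: norm_eq_1)
  define U where "U = {z. z - r *\<^sub>R \<nu> \<in> lower_cyl x \<nu> r}"
  have "(\<lambda>z. z + - (r *\<^sub>R \<nu>)) -` lower_cyl x \<nu> r \<inter> space lebesgue \<in> sets lebesgue"
    by (rule measurable_sets[OF lebesgue_measurable_shift sets_cyl(2)[OF \<nu>]])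
  then have [measurable]: "U \<in> sets lebesgue" by (simp add: U_def vimage_def)
  have U: "z \<in> U \<longleftrightarrow> norm (z - x - (\<nu> \<bullet> (z - x)) *\<^sub>R \<nu>) < r \<and> 0 < \<nu> \<bullet> (z - x) \<and> \<nu> \<bullet> (z - x) \<le> r" for z
  proof -
    have e: "\<nu> \<bullet> (z - r *\<^sub>R \<nu> - x) = \<nu> \<bullet> (z - x) - r" by (simp add: nn inner_diff_right)
    have v: "z - r *\<^sub>R \<nu> - x - (\<nu> \<bullet> (z - x) - r) *\<^sub>R \<nu> = z - x - (\<nu> \<bullet> (z - x)) *\<^sub>R \<nu>"
      by (simp add: algebra_simps)
    show ?thesis unfolding U_def mem_Collect_eq mem_lower_cyl_iff[OF \<nu>] e v by linarith
  qed
  have "(\<integral>\<^sup>+z\<in>lower_cyl x \<nu> r. (h (z + r *\<^sub>R \<nu>) + h z) \<partial>lebesgue)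
      = (\<integral>\<^sup>+z. h (z + r *\<^sub>R \<nu>) * indicator U (z + r *\<^sub>R \<nu>) + h z * indicator (lower_cyl x \<nu> r) z \<partial>lebesgue)"
    by (intro nn_integral_cong) (auto simp: U_def indicator_def)
  also have "\<dots> = (\<integral>\<^sup>+z. h (z + r *\<^sub>R \<nu>) * indicator U (z + r *\<^sub>R \<nu>) \<partial>lebesgue)
      + (\<integral>\<^sup>+z. h z * indicator (lower_cyl x \<nu> r) z \<partial>lebesgue)"
  proof (rule nn_integral_add)
    have "(\<lambda>z. h z * indicator U z) \<in> borel_measurable lebesgue" by measurable
    from measurable_compose[OF lebesgue_measurable_shift this]
    show "(\<lambda>z. h (z + r *\<^sub>R \<nu>) * indicator U (z + r *\<^sub>R \<nu>)) \<in> borel_measurable lebesgue" .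
  qed measurable
  also have "(\<integral>\<^sup>+z. h (z + r *\<^sub>R \<nu>) * indicator U (z + r *\<^sub>R \<nu>) \<partial>lebesgue) = (\<integral>\<^sup>+z. h z * indicator U z \<partial>lebesgue)"
    by (rule nn_integral_lebesgue_shift[of "\<lambda>z. h z * indicator U z"]) measurable
  also have "\<dots> + (\<integral>\<^sup>+z. h z * indicator (lower_cyl x \<nu> r) z \<partial>lebesgue)
      = (\<integral>\<^sup>+z. h z * indicator U z + h z * indicator (lower_cyl x \<nu> r) z \<partial>lebesgue)"
    by (rule nn_integral_add[symmetric]) measurable
  also have "\<dots> = (\<integral>\<^sup>+z\<in>cyl x \<nu> r. h z \<partial>lebesgue)"
  proof (rule nn_integral_cong_AE)
    have "AE z in lebesgue. \<nu> \<bullet> z \<noteq> \<nu> \<bullet> x + r" using \<nu> by (intro AE_not_in_hyperplane) auto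
    then show "AE z in lebesgue. h z * indicator U z + h z * indicator (lower_cyl x \<nu> r) z = h z * indicator (cyl x \<nu> r) z"
    proof eventually_elim
      case (elim z)
      then have "\<nu> \<bullet> (z - x) \<noteq> r" by (simp add: inner_diff_right)
      then show ?case using \<open>0 < r\<close>
        by (auto simp: indicator_def U mem_cyl_iff[OF \<nu>] mem_lower_cyl_iff[OF \<nu>])
    qed
  qed
  finally show ?thesis .
qed

text \<open>
  This is the tiling identity for the constant function 1.
\<close>

lemma emeasure_cyl:
  fixes \<nu> :: "'a::euclidean_space"
  assumes "norm \<nu> = 1" and "0 < r"
  shows "emeasure lebesgue (cyl x \<nu> r) = 2 * emeasure lebesgue (lower_cyl x \<nu> r)"
proof -
  have "(\<integral>\<^sup>+z\<in>cyl x \<nu> r. 1 \<partial>lebesgue) = (\<integral>\<^sup>+z\<in>lower_cyl x \<nu> r. 2 \<partial>lebesgue)"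
    using nn_integral_lower_cyl_shift_add[OF assms, of "\<lambda>_. 1" x] by simp
  then show ?thesis using sets_cyl[OF assms(1)] by (simp add: nn_integral_cmult_indicator)
qed

lemma emeasure_ball_pos_finite:
  fixes x :: "'a::euclidean_space"
  assumes "0 < r"
  shows "0 < emeasure lebesgue (ball x r)" "emeasure lebesgue (ball x r) < \<infinity>"
proof -
  show "emeasure lebesgue (ball x r) < \<infinity>" using emeasure_lborel_ball_finite[of x r] by simp
  show "0 < emeasure lebesgue (ball x r)" using assms
    by (simp add: emeasure_ball unit_ball_vol_def)
qed

lemma emeasure_cyl_pos_finite:
  fixes \<nu> :: "'a::euclidean_space"
  assumes "norm \<nu> = 1" and "0 < r"
  shows "0 < emeasure lebesgue (cyl x \<nu> r)" "emeasure lebesgue (cyl x \<nu> r) < \<infinity>"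
proof -
  show "0 < emeasure lebesgue (cyl x \<nu> r)"
    using emeasure_ball_pos_finite(1)[OF assms(2), of x]
      emeasure_mono[OF ball_subset_cyl[OF assms(1)] sets_cyl(1)[OF assms(1)], of x r] by (rule less_le_trans)
  have "emeasure lebesgue (cyl x \<nu> r) \<le> emeasure lebesgue (ball x (2 * r))"
    by (rule emeasure_mono[OF cyl_subset_ball[OF assms(1)]]) auto
  also have "\<dots> < \<infinity>" using assms by (intro emeasure_ball_pos_finite) auto
  finally show "emeasure lebesgue (cyl x \<nu> r) < \<infinity>" .
qed

lemma emeasure_lower_cyl_pos_finite:
  fixes \<nu> :: "'a::euclidean_space"
  assumes "norm \<nu> = 1" and "0 < r"
  shows "0 < emeasure lebesgue (lower_cyl x \<nu> r)" "emeasure lebesgue (lower_cyl x \<nu> r) < \<infinity>"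
  using emeasure_cyl_pos_finite[OF assms, of x] emeasure_cyl[OF assms, of x]
  by (auto simp: ennreal_zero_less_mult_iff ennreal_mult_less_top)

lemma nn_avg_const:
  assumes "A \<in> sets lebesgue" "0 < emeasure lebesgue A" "emeasure lebesgue A < \<infinity>"
  shows "nn_avg A (\<lambda>_. c) = c"
proof -
  have "nn_avg A (\<lambda>_. c) = c * emeasure lebesgue A / emeasure lebesgue A"
    using assms(1) by (simp add: nn_avg_def nn_integral_cmult_indicator)
  also have "\<dots> = c" using assms(2,3) by (intro mult_divide_eq_ennreal) auto
  finally show ?thesis .
qed

text \<open>
  The factor 2 is the ratio of the measures of the two cylinders. Measurability of \<open>h\<close> is
  asked only on a ball that contains the cylinder and the shifted lower cylinder, since
  \<open>f\<close> is measurable only on \<open>\<Omega>\<close>; the proof extends \<open>h\<close> by 0.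
\<close>

lemma nn_avg_lower_cyl_le:
  fixes \<nu> :: "'a::euclidean_space"
  assumes \<nu>: "norm \<nu> = 1" and "0 < r"
    and h: "h \<in> borel_measurable (lebesgue_on (ball x (2 * r)))"
    and p: "p \<in> borel_measurable (lebesgue_on (lower_cyl x \<nu> r))"
    and le: "AE z in lebesgue. z \<in> lower_cyl x \<nu> r \<longrightarrow> u z \<le> p z + K * (h (z + r *\<^sub>R \<nu>) + h z)"
  shows "nn_avg (lower_cyl x \<nu> r) u \<le> nn_avg (lower_cyl x \<nu> r) p + 2 * K * nn_avg (cyl x \<nu> r) h"
proof -
  note [measurable] = sets_cyl[OF \<nu>]
  let ?L = "lower_cyl x \<nu> r" and ?Q = "cyl x \<nu> r"
  define H where "H = (\<lambda>z. h z * indicator (ball x (2 * r)) z)"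
  have H[measurable]: "H \<in> borel_measurable lebesgue"
    using h unfolding H_def by (subst (asm) borel_measurable_restrict_space_iff_ennreal) auto
  have [measurable]: "(\<lambda>z. H (z + r *\<^sub>R \<nu>)) \<in> borel_measurable lebesgue"
    by (rule measurable_compose[OF lebesgue_measurable_shift H])
  have p'[measurable]: "(\<lambda>z. p z * indicator ?L z) \<in> borel_measurable lebesgue"
    using p by (subst (asm) borel_measurable_restrict_space_iff_ennreal) auto
  have H_eq: "H z = h z" "H (z + r *\<^sub>R \<nu>) = h (z + r *\<^sub>R \<nu>)" if "z \<in> ?L" for z
    using that shift_lower_cyl_subset_ball[OF \<nu> that] lower_cyl_subset_cyl[of x \<nu> r] cyl_subset_ball[OF \<nu>, of x r]
    unfolding H_def by (auto simp: subset_eq simp del: mem_ball)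
  have "(\<integral>\<^sup>+z\<in>?L. u z \<partial>lebesgue)
      \<le> (\<integral>\<^sup>+z. p z * indicator ?L z + K * ((H (z + r *\<^sub>R \<nu>) + H z) * indicator ?L z) \<partial>lebesgue)"
    using le by (intro nn_integral_mono_AE) (auto elim!: eventually_mono simp: indicator_def H_eq)
  also have "\<dots> = (\<integral>\<^sup>+z\<in>?L. p z \<partial>lebesgue) + (\<integral>\<^sup>+z. K * ((H (z + r *\<^sub>R \<nu>) + H z) * indicator ?L z) \<partial>lebesgue)"
    by (rule nn_integral_add[OF p']) measurable
  also have "(\<integral>\<^sup>+z. K * ((H (z + r *\<^sub>R \<nu>) + H z) * indicator ?L z) \<partial>lebesgue)
      = K * (\<integral>\<^sup>+z\<in>?L. (H (z + r *\<^sub>R \<nu>) + H z) \<partial>lebesgue)"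
    by (rule nn_integral_cmult) measurable
  also have "(\<integral>\<^sup>+z\<in>?L. (H (z + r *\<^sub>R \<nu>) + H z) \<partial>lebesgue) = (\<integral>\<^sup>+z\<in>?Q. H z \<partial>lebesgue)"
    by (rule nn_integral_lower_cyl_shift_add[OF \<nu> \<open>0 < r\<close> H])
  also have "\<dots> = (\<integral>\<^sup>+z\<in>?Q. h z \<partial>lebesgue)"
    using cyl_subset_ball[OF \<nu>, of x r]
    by (intro nn_integral_cong) (auto simp: H_def indicator_def subset_eq simp del: mem_ball)
  finally have "nn_avg ?L u \<le> ((\<integral>\<^sup>+z\<in>?L. p z \<partial>lebesgue) + K * (\<integral>\<^sup>+z\<in>?Q. h z \<partial>lebesgue)) / emeasure lebesgue ?L"
    unfolding nn_avg_def by (rule divide_right_mono_ennreal)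
  also have "\<dots> = nn_avg ?L p + K * ((\<integral>\<^sup>+z\<in>?Q. h z \<partial>lebesgue) / emeasure lebesgue ?L)"
    unfolding nn_avg_def add_divide_distrib_ennreal ennreal_times_divide ..
  also have "(\<integral>\<^sup>+z\<in>?Q. h z \<partial>lebesgue) / emeasure lebesgue ?L = 2 * nn_avg ?Q h"
  proof -
    have "2 * nn_avg ?Q h = (\<integral>\<^sup>+z\<in>?Q. h z \<partial>lebesgue) * 2 / (emeasure lebesgue ?L * 2)"
      unfolding nn_avg_def emeasure_cyl[OF \<nu> \<open>0 < r\<close>] ennreal_times_divide by (simp only: mult.commute)
    also have "\<dots> = (\<integral>\<^sup>+z\<in>?Q. h z \<partial>lebesgue) / emeasure lebesgue ?L"
      by (rule divide_mult_eq) auto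
    finally show ?thesis by simp
  qed
  finally show ?thesis by (simp only: mult_ac)
qed

lemma nn_avg_subset_le:
  assumes "A \<subseteq> B" "0 < emeasure lebesgue A" "emeasure lebesgue A < \<infinity>"
    and "emeasure lebesgue B \<le> k * emeasure lebesgue A" "0 < emeasure lebesgue B" "k < \<infinity>"
  shows "nn_avg A h \<le> k * nn_avg B h"
proof -
  let ?I = "\<lambda>S. \<integral>\<^sup>+z\<in>S. h z \<partial>lebesgue"
  let ?a = "emeasure lebesgue A" and ?b = "emeasure lebesgue B"
  have b: "?b < \<infinity>" using assms(3,4,6) by (metis ennreal_mult_less_top infinity_ennreal_def order_le_less_trans)
  have "?I A \<le> ?I B" using assms(1)
    by (intro nn_integral_mono) (auto simp: indicator_def)
  then have "nn_avg A h \<le> ?I B / ?a" unfolding nn_avg_def by (rule divide_right_mono_ennreal)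
  also have "?I B / ?a = (?I B / ?b * ?b) / ?a"
    using b assms(5) by (subst ennreal_divide_times) (simp add: less_top[symmetric])
  also have "\<dots> \<le> (?I B / ?b * (k * ?a)) / ?a"
    by (intro divide_right_mono_ennreal mult_left_mono assms) auto
  also have "\<dots> = k * (?I B / ?b)"
    unfolding mult.assoc[symmetric] using assms(2,3)
    by (subst mult_divide_eq_ennreal) (auto simp: mult.commute)
  finally show ?thesis unfolding nn_avg_def .
qed

text \<open>
  The ball of radius \<open>2 r\<close> contains the cylinder, and the cylinder contains the ball of
  radius \<open>r\<close>, so the measures compare up to a factor depending on the dimension only.
\<close>

lemma nn_avg_cyl_le_ball:
  fixes \<nu> :: "'a::euclidean_space"
  assumes "norm \<nu> = 1" and "0 < r"
  shows "nn_avg (cyl x \<nu> r) h \<le> 2 ^ DIM('a) * nn_avg (ball x (2 * r)) h"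
proof (rule nn_avg_subset_le[OF cyl_subset_ball[OF assms(1)] emeasure_cyl_pos_finite[OF assms]])
  have "emeasure lebesgue (ball x (2 * r)) = 2 ^ DIM('a) * emeasure lebesgue (ball x r)"
    using emeasure_lebesgue_ball_conv_unit_ball[of "2 * r" x] emeasure_lebesgue_ball_conv_unit_ball[of r x] assms(2)
    by (simp add: power_mult_distrib ennreal_mult' ennreal_power[symmetric] mult.assoc)
  also have "\<dots> \<le> 2 ^ DIM('a) * emeasure lebesgue (cyl x \<nu> r)"
    by (intro mult_left_mono emeasure_mono ball_subset_cyl sets_cyl assms) auto
  finally show "emeasure lebesgue (ball x (2 * r)) \<le> 2 ^ DIM('a) * emeasure lebesgue (cyl x \<nu> r)" .
qed (use assms emeasure_ball_pos_finite(1)[of "2 * r" x] in \<open>auto simp: power_less_top_ennreal\<close>)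

section \<open>Oscillation bound and 2-Lebesgue points\<close>

lemma eventually_double_ball_subset:
  fixes x :: "'a::metric_space"
  assumes "open \<Omega>" "x \<in> \<Omega>" "0 < R"
  shows "\<forall>\<^sub>F r in at_right (0::real). 0 < r \<and> 2 * r \<le> R \<and> ball x (2 * r) \<subseteq> \<Omega>"
proof -
  obtain e where e: "0 < e" "ball x e \<subseteq> \<Omega>" using assms openE by blast
  have "min e R / 2 > 0" using e assms by simp
  then have "\<forall>\<^sub>F r in at_right 0. 0 < r \<and> r < min e R / 2"
    by (auto simp: eventually_at_right_field intro!: exI[of _ "min e R / 2"])
  then show ?thesis
  proof eventually_elim
    case (elim r)
    then have "ball x (2 * r) \<subseteq> ball x e" by (intro subset_ball) auto
    with elim e show ?case by auto
  qed
qed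

lemma filterlim_double_at_right: "filterlim (\<lambda>r::real. 2 * r) (at_right 0) (at_right 0)"
  unfolding filterlim_at
  by (auto intro!: tendsto_eq_intros eventually_at_rightI[of 0 1])

lemma tendsto_mult_0_ennreal:
  fixes e :: "_ \<Rightarrow> ennreal"
  assumes "M < \<infinity>" "(e \<longlongrightarrow> 0) F"
  shows "((\<lambda>r. M * e r) \<longlongrightarrow> 0) F"
  using ennreal_tendsto_cmult[OF _ assms(2), of M] assms(1) by simp

lemma tendsto_cmult_nn_avg_double:
  assumes "((\<lambda>r. nn_avg (ball x r) h) \<longlongrightarrow> 0) (at_right 0)" "M < \<infinity>"
  shows "((\<lambda>r. M * nn_avg (ball x (2 * r)) h) \<longlongrightarrow> 0) (at_right 0)"
  by (rule tendsto_mult_0_ennreal[OF assms(2) filterlim_compose[OF assms(1) filterlim_double_at_right]])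

lemma Limsup_cmult_ennreal:
  fixes M :: ennreal
  assumes "M < \<infinity>" "F \<noteq> bot"
  shows "Limsup F (\<lambda>r. M * g r) = M * Limsup F g"
  by (rule Limsup_compose_continuous_mono[OF ennreal_continuous_on_cmult])
    (use assms in \<open>auto intro!: monoI mult_left_mono continuous_on_id\<close>)

lemma norm_diff_squared_le:
  fixes a b c :: "'b::real_inner"
  shows "(norm (a - b))\<^sup>2 \<le> 2 * ((norm (a - c))\<^sup>2 + (norm (b - c))\<^sup>2)"
proof -
  have "norm (a - b) \<le> norm (a - c) + norm (b - c)"
    using norm_triangle_ineq4[of "a - c" "b - c"] by simp
  then have "(norm (a - b))\<^sup>2 \<le> (norm (a - c) + norm (b - c))\<^sup>2"
    by (intro power_mono) auto
  also have "\<dots> \<le> 2 * ((norm (a - c))\<^sup>2 + (norm (b - c))\<^sup>2)"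
    using zero_le_power2[of "norm (a - c) - norm (b - c)"] by (simp add: power2_sum power2_diff)
  finally show ?thesis .
qed

text \<open>
  The constants \<open>c \<tau>\<close> are arbitrary so that the same bound serves with the mean over the
  cylinder and with a fixed value of \<open>f\<close>.
\<close>

lemma jdir_squared_le_oscillation:
  fixes f :: "'a::euclidean_space \<Rightarrow> 'b::euclidean_space" and c :: "real \<Rightarrow> 'b"
  assumes "open \<Omega>" "x0 \<in> \<Omega>" and f: "f \<in> borel_measurable (lebesgue_on \<Omega>)" and \<nu>: "norm \<nu> = 1"
  shows "(jdir f \<nu> x0)\<^sup>2
    \<le> 4 * Limsup (at_right 0) (\<lambda>\<tau>. nn_avg (cyl x0 \<nu> \<tau>) (\<lambda>x. ennreal ((norm (f x - c \<tau>))\<^sup>2)))"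
proof -
  let ?u = "\<lambda>\<tau> x. ennreal ((norm (f (x + \<tau> *\<^sub>R \<nu>) - f x))\<^sup>2)"
  let ?h = "\<lambda>\<tau> x. ennreal ((norm (f x - c \<tau>))\<^sup>2)"
  have "\<forall>\<^sub>F \<tau> in at_right 0. nn_avg (lower_cyl x0 \<nu> \<tau>) (?u \<tau>) \<le> 4 * nn_avg (cyl x0 \<nu> \<tau>) (?h \<tau>)"
    using eventually_double_ball_subset[OF assms(1,2) zero_less_one]
  proof eventually_elim
    case (elim \<tau>)
    then have [measurable]: "f \<in> borel_measurable (lebesgue_on (ball x0 (2 * \<tau>)))"
      using measurable_restrict_mono[OF f] by blast
    have "nn_avg (lower_cyl x0 \<nu> \<tau>) (?u \<tau>)
        \<le> nn_avg (lower_cyl x0 \<nu> \<tau>) (\<lambda>_. 0) + 2 * 2 * nn_avg (cyl x0 \<nu> \<tau>) (?h \<tau>)"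
    proof (rule nn_avg_lower_cyl_le[OF \<nu>])
      show "AE z in lebesgue. z \<in> lower_cyl x0 \<nu> \<tau> \<longrightarrow>
          ?u \<tau> z \<le> 0 + 2 * (?h \<tau> (z + \<tau> *\<^sub>R \<nu>) + ?h \<tau> z)"
        using norm_diff_squared_le
        by (auto simp: ennreal_plus[symmetric] ennreal_mult''[symmetric] ennreal_numeral[symmetric]
            simp del: ennreal_plus ennreal_numeral intro!: ennreal_leI)
    qed (use elim in \<open>simp, measurable\<close>)
    then show ?case by (simp add: nn_avg_def)
  qed
  then have "Limsup (at_right 0) (\<lambda>\<tau>. nn_avg (lower_cyl x0 \<nu> \<tau>) (?u \<tau>))
      \<le> Limsup (at_right 0) (\<lambda>\<tau>. 4 * nn_avg (cyl x0 \<nu> \<tau>) (?h \<tau>))"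
    by (rule Limsup_mono)
  also have "\<dots> = 4 * Limsup (at_right 0) (\<lambda>\<tau>. nn_avg (cyl x0 \<nu> \<tau>) (?h \<tau>))"
    by (rule Limsup_cmult_ennreal) auto
  finally show ?thesis by (simp add: jdir_def ennsqrt_power2)
qed

lemma jdir_eq_0_if_L2_average_tendsto_0:
  fixes f :: "'a::euclidean_space \<Rightarrow> 'b::euclidean_space"
  assumes "open \<Omega>" "x0 \<in> \<Omega>" and f: "f \<in> borel_measurable (lebesgue_on \<Omega>)" and \<nu>: "norm \<nu> = 1"
    and lim: "((\<lambda>r. nn_avg (ball x0 r) (\<lambda>y. ennreal ((norm (f y - z))\<^sup>2))) \<longlongrightarrow> 0) (at_right 0)"
  shows "jdir f \<nu> x0 = 0"
proof -
  let ?h = "\<lambda>y. ennreal ((norm (f y - z))\<^sup>2)"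
  have "Limsup (at_right 0) (\<lambda>\<tau>. nn_avg (cyl x0 \<nu> \<tau>) ?h)
      \<le> Limsup (at_right 0) (\<lambda>\<tau>. 2 ^ DIM('a) * nn_avg (ball x0 (2 * \<tau>)) ?h)"
    by (intro Limsup_mono eventually_mono[OF eventually_at_right_less[of 0]] nn_avg_cyl_le_ball \<nu>)
  also have "\<dots> = 0"
    by (intro lim_imp_Limsup tendsto_cmult_nn_avg_double lim) (auto simp: power_less_top_ennreal)
  finally have "(jdir f \<nu> x0)\<^sup>2 = 0"
    using jdir_squared_le_oscillation[OF assms(1-4), of "\<lambda>_. z"] by simp
  then show ?thesis by simp
qed

section \<open>Comparison with a two-phase function\<close>

text \<open>
  The strict inequality puts points of height 0 into the phase \<open>b\<close>. Thus the whole
  lower cylinder, base included, carries the value \<open>b\<close>, and its shift, which has heights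
  in \<open>(0, r]\<close>, carries \<open>a\<close>.
\<close>

definition two_phase :: "'a::real_inner \<Rightarrow> 'a \<Rightarrow> 'b \<Rightarrow> 'b \<Rightarrow> 'a \<Rightarrow> 'b" where
  "two_phase x \<nu> a b y = (if 0 < \<nu> \<bullet> (y - x) then a else b)"

lemma two_phase_measurable [measurable]:
  fixes x :: "'a::euclidean_space" and a b :: "'b::euclidean_space"
  shows "two_phase x \<nu> a b \<in> borel_measurable (lebesgue_on S)"
proof -
  have "two_phase x \<nu> a b \<in> borel_measurable borel"
    unfolding two_phase_def[abs_def] by measurable
  then show ?thesis
    by (intro measurable_restrict_space1 measurable_completion) simp
qed

lemma two_phase_shift:
  fixes \<nu> :: "'a::euclidean_space"
  assumes "norm \<nu> = 1" "z \<in> lower_cyl x \<nu> r"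
  shows "two_phase x \<nu> a b z = b" "two_phase x \<nu> a b (z + r *\<^sub>R \<nu>) = a"
proof -
  have "\<nu> \<bullet> \<nu> = 1" using assms by (simp add: norm_eq_1)
  then have "\<nu> \<bullet> (z + r *\<^sub>R \<nu> - x) = \<nu> \<bullet> (z - x) + r" by (simp add: inner_diff_right inner_add_right)
  then show "two_phase x \<nu> a b z = b" "two_phase x \<nu> a b (z + r *\<^sub>R \<nu>) = a"
    using assms by (auto simp: two_phase_def mem_lower_cyl_iff)
qed

lemma norm_two_phase_diff_le: "norm (two_phase x \<nu> a b y - two_phase x \<nu> a b z) \<le> norm (a - b)"
  by (auto simp: two_phase_def norm_minus_commute)

text \<open>
  The Lipschitz bound for the square is what allows convergence in \<open>L\<^sup>1\<close> to control
  squared increments of bounded functions.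
\<close>

lemma abs_norm_squared_diff_le:
  fixes p q :: "'b::real_normed_vector"
  assumes "norm p \<le> 2 * C" "norm q \<le> 2 * C"
  shows "\<bar>(norm p)\<^sup>2 - (norm q)\<^sup>2\<bar> \<le> 4 * C * norm (p - q)"
proof -
  have "\<bar>(norm p)\<^sup>2 - (norm q)\<^sup>2\<bar> = \<bar>norm p - norm q\<bar> * (norm p + norm q)"
    by (simp add: power2_eq_square square_diff_square_factored abs_mult)
  also have "\<dots> \<le> norm (p - q) * (4 * C)"
    using assms by (intro mult_mono norm_triangle_ineq3) auto
  finally show ?thesis by (simp add: mult.commute)
qed

lemma inverse_antimono_ennreal:
  fixes a b :: ennreal
  assumes "a \<le> b"
  shows "inverse b \<le> inverse a"
  using assms including ennreal.lifting by transfer (rule ereal_inverse_antimono)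

text \<open>
  On each half ball \<open>two_phase\<close> is one of the two constants, and averages over the ball are
  at most averages over a half ball, which has smaller measure.
\<close>

lemma nn_avg_ball_two_phase_le:
  fixes f :: "'a::euclidean_space \<Rightarrow> 'b::euclidean_space"
  assumes f: "f \<in> borel_measurable (lebesgue_on (ball x r))"
  shows "nn_avg (ball x r) (\<lambda>y. ennreal (norm (f y - two_phase x \<nu> a b y)))
    \<le> nn_avg (half_ball x \<nu> r) (\<lambda>y. ennreal (norm (f y - a)))
      + nn_avg (half_ball x (-\<nu>) r) (\<lambda>y. ennreal (norm (f y - b)))"
proof -
  let ?B = "ball x r"
  have half: "half_ball x v r \<in> sets lebesgue" for v
  proof -
    have "half_ball x v r = ?B \<inter> {y. 0 \<le> v \<bullet> (y - x)}" by (auto simp: half_ball_def)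
    also have "\<dots> \<in> sets borel" by measurable
    finally show ?thesis by simp
  qed
  have m: "(\<lambda>y. ennreal (norm (f y - c)) * indicator (half_ball x v r) y) \<in> borel_measurable lebesgue" for c v
  proof -
    have "f \<in> borel_measurable (lebesgue_on (half_ball x v r))"
      by (rule measurable_restrict_mono[OF f]) (auto simp: half_ball_def)
    then have "(\<lambda>y. ennreal (norm (f y - c))) \<in> borel_measurable (lebesgue_on (half_ball x v r))" by measurable
    then show ?thesis using half by (subst (asm) borel_measurable_restrict_space_iff_ennreal) auto
  qed
  have div: "I / emeasure lebesgue ?B \<le> I / emeasure lebesgue (half_ball x v r)" for I v
    unfolding divide_ennreal_def
    by (intro mult_left_mono inverse_antimono_ennreal emeasure_mono) (auto simp: half_ball_def)
  have "(\<integral>\<^sup>+y\<in>?B. ennreal (norm (f y - two_phase x \<nu> a b y)) \<partial>lebesgue)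
      \<le> (\<integral>\<^sup>+y. ennreal (norm (f y - a)) * indicator (half_ball x \<nu> r) y
            + ennreal (norm (f y - b)) * indicator (half_ball x (-\<nu>) r) y \<partial>lebesgue)"
    by (intro nn_integral_mono) (auto simp: indicator_def two_phase_def half_ball_def)
  also have "\<dots> = (\<integral>\<^sup>+y\<in>half_ball x \<nu> r. ennreal (norm (f y - a)) \<partial>lebesgue)
      + (\<integral>\<^sup>+y\<in>half_ball x (-\<nu>) r. ennreal (norm (f y - b)) \<partial>lebesgue)"
    by (rule nn_integral_add[OF m m])
  finally have "nn_avg ?B (\<lambda>y. ennreal (norm (f y - two_phase x \<nu> a b y)))
      \<le> (\<integral>\<^sup>+y\<in>half_ball x \<nu> r. ennreal (norm (f y - a)) \<partial>lebesgue) / emeasure lebesgue ?B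
      + (\<integral>\<^sup>+y\<in>half_ball x (-\<nu>) r. ennreal (norm (f y - b)) \<partial>lebesgue) / emeasure lebesgue ?B"
    unfolding nn_avg_def add_divide_distrib_ennreal[symmetric] by (rule divide_right_mono_ennreal)
  also have "\<dots> \<le> nn_avg (half_ball x \<nu> r) (\<lambda>y. ennreal (norm (f y - a)))
      + nn_avg (half_ball x (-\<nu>) r) (\<lambda>y. ennreal (norm (f y - b)))"
    unfolding nn_avg_def by (intro add_mono div)
  finally show ?thesis .
qed

lemma ennsqrt_le_iff: "ennsqrt a \<le> b \<longleftrightarrow> a \<le> b\<^sup>2"
proof
  assume "ennsqrt a \<le> b"
  then have "(ennsqrt a)\<^sup>2 \<le> b\<^sup>2" by (intro power_mono) auto
  then show "a \<le> b\<^sup>2" by (simp add: ennsqrt_power2)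
next
  assume *: "a \<le> b\<^sup>2"
  show "ennsqrt a \<le> b"
  proof (cases a; cases b)
    fix r s assume rs: "0 \<le> r" "a = ennreal r" "0 \<le> s" "b = ennreal s"
    with * have "r \<le> s\<^sup>2" by (simp add: ennreal_power)
    then show ?thesis using rs by (auto simp: ennsqrt_def intro!: ennreal_leI real_le_lsqrt)
  qed (use * in \<open>auto simp: ennsqrt_def ennreal_power top_unique\<close>)
qed

lemma le_ennsqrt_iff: "b \<le> ennsqrt a \<longleftrightarrow> b\<^sup>2 \<le> a"
proof
  assume "b \<le> ennsqrt a"
  then have "b\<^sup>2 \<le> (ennsqrt a)\<^sup>2" by (intro power_mono) auto
  then show "b\<^sup>2 \<le> a" by (simp add: ennsqrt_power2)
next
  assume *: "b\<^sup>2 \<le> a"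
  show "b \<le> ennsqrt a"
  proof (cases a; cases b)
    fix r s assume rs: "0 \<le> r" "a = ennreal r" "0 \<le> s" "b = ennreal s"
    with * have "s\<^sup>2 \<le> r" by (simp add: ennreal_power)
    then show ?thesis using rs by (auto simp: ennsqrt_def intro!: ennreal_leI real_le_rsqrt)
  qed (use * in \<open>auto simp: ennsqrt_def ennreal_power top_unique\<close>)
qed

text \<open>
  Let \<open>w\<close> be the two-phase function. By \<open>abs_norm_squared_diff_le\<close> the squared increments
  of \<open>f\<close> and \<open>w\<close> differ by at most \<open>4 C\<close> times the sum of \<open>|f - w|\<close> at the two
  points, where \<open>C\<close> bounds both functions near \<open>x0\<close>. Feeding each of the two resulting
  inequalities into \<open>nn_avg_lower_cyl_le\<close> leaves an error that vanishes by the
  hypothesis. With \<open>\<mu> = 0\<close> the function \<open>w\<close> is constant,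
  which is how points off \<open>S_f\<close> are treated.
\<close>

lemma
  fixes f :: "'a::euclidean_space \<Rightarrow> 'b::euclidean_space"
  assumes "open \<Omega>" "x0 \<in> \<Omega>" and f: "f \<in> Linf_loc \<Omega>"
    and lim: "((\<lambda>r. nn_avg (ball x0 r) (\<lambda>y. ennreal (norm (f y - two_phase x0 \<mu> a b y)))) \<longlongrightarrow> 0) (at_right 0)"
  shows jdir_le_two_phase: "norm \<nu> = 1 \<Longrightarrow> jdir f \<nu> x0 \<le> ennreal (norm (a - b))"
    and jdir_ge_two_phase: "norm \<mu> = 1 \<Longrightarrow> ennreal (norm (a - b)) \<le> jdir f \<mu> x0"
proof -
  let ?w = "two_phase x0 \<mu> a b"
  let ?h = "\<lambda>y. ennreal (norm (f y - ?w y))"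
  let ?D2 = "ennreal ((norm (a - b))\<^sup>2)"
  let ?u = "\<lambda>\<nu> \<tau> x. ennreal ((norm (f (x + \<tau> *\<^sub>R \<nu>) - f x))\<^sup>2)"
  have f_meas: "f \<in> borel_measurable (lebesgue_on \<Omega>)" using f by (simp add: Linf_loc_def)
  obtain R where R: "0 < R" "cball x0 R \<subseteq> \<Omega>" using assms(1,2) open_contains_cball by blast
  then obtain C0 where C0: "AE x in lebesgue. x \<in> cball x0 R \<longrightarrow> norm (f x) \<le> C0"
    using f unfolding Linf_loc_def by (auto dest: spec[of _ "cball x0 R"])
  \<comment> \<open>One bound for \<open>f\<close> and the two-phase function, so that all increments are at most \<open>2 C\<close>.\<close>
  define C where "C = max C0 (max (norm a) (norm b))"
  have C: "norm a \<le> C" "norm b \<le> C" "0 \<le> C" "C0 \<le> C"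
    using norm_ge_zero[of a] unfolding C_def by linarith+
  then have w_le: "norm (?w y) \<le> C" for y by (simp add: two_phase_def)
  have bound: "AE z in lebesgue. z \<in> lower_cyl x0 \<nu> \<tau> \<longrightarrow>
      \<bar>(norm (f (z + \<tau> *\<^sub>R \<nu>) - f z))\<^sup>2 - (norm (?w (z + \<tau> *\<^sub>R \<nu>) - ?w z))\<^sup>2\<bar>
        \<le> 4 * C * (norm (f (z + \<tau> *\<^sub>R \<nu>) - ?w (z + \<tau> *\<^sub>R \<nu>)) + norm (f z - ?w z))"
    if \<nu>: "norm \<nu> = 1" and \<tau>: "2 * \<tau> \<le> R" for \<nu> \<tau>
    using C0 AE_lebesgue_shift[OF C0, of "\<tau> *\<^sub>R \<nu>"]
  proof eventually_elim
    case (elim z)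
    show ?case
    proof
      assume z: "z \<in> lower_cyl x0 \<nu> \<tau>"
      have "ball x0 (2 * \<tau>) \<subseteq> cball x0 R" using \<tau> by auto
      then have "norm (f z) \<le> C" "norm (f (z + \<tau> *\<^sub>R \<nu>)) \<le> C"
        using elim z shift_lower_cyl_subset_ball[OF \<nu> z] lower_cyl_subset_cyl[of x0 \<nu> \<tau>]
          cyl_subset_ball[OF \<nu>, of x0 \<tau>] C(4) by (meson order_trans subsetD)+
      then have "norm (f (z + \<tau> *\<^sub>R \<nu>) - f z) \<le> 2 * C"
        using norm_triangle_ineq4[of "f (z + \<tau> *\<^sub>R \<nu>)" "f z"] by linarith
      moreover have "norm (?w (z + \<tau> *\<^sub>R \<nu>) - ?w z) \<le> 2 * C"
        using norm_triangle_ineq4[of "?w (z + \<tau> *\<^sub>R \<nu>)" "?w z"] w_le[of z] w_le[of "z + \<tau> *\<^sub>R \<nu>"] by linarith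
      ultimately have "\<bar>(norm (f (z + \<tau> *\<^sub>R \<nu>) - f z))\<^sup>2 - (norm (?w (z + \<tau> *\<^sub>R \<nu>) - ?w z))\<^sup>2\<bar>
          \<le> 4 * C * norm (f (z + \<tau> *\<^sub>R \<nu>) - f z - (?w (z + \<tau> *\<^sub>R \<nu>) - ?w z))"
        by (rule abs_norm_squared_diff_le)
      also have "\<dots> \<le> 4 * C * (norm (f (z + \<tau> *\<^sub>R \<nu>) - ?w (z + \<tau> *\<^sub>R \<nu>)) + norm (f z - ?w z))"
        using C(3) norm_triangle_ineq4[of "f (z + \<tau> *\<^sub>R \<nu>) - ?w (z + \<tau> *\<^sub>R \<nu>)" "f z - ?w z"]
        by (intro mult_left_mono) (auto simp: algebra_simps)
      finally show "\<bar>(norm (f (z + \<tau> *\<^sub>R \<nu>) - f z))\<^sup>2 - (norm (?w (z + \<tau> *\<^sub>R \<nu>) - ?w z))\<^sup>2\<bar>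
        \<le> 4 * C * (norm (f (z + \<tau> *\<^sub>R \<nu>) - ?w (z + \<tau> *\<^sub>R \<nu>)) + norm (f z - ?w z))" .
    qed
  qed
  have enn_le: "ennreal s \<le> ennreal t + ennreal (4 * C) * (ennreal \<alpha> + ennreal \<beta>)"
    if "s \<le> t + 4 * C * (\<alpha> + \<beta>)" "0 \<le> t" "0 \<le> \<alpha>" "0 \<le> \<beta>" for s t \<alpha> \<beta>
  proof -
    have "ennreal s \<le> ennreal (t + 4 * C * (\<alpha> + \<beta>))" using that by (intro ennreal_leI)
    also have "\<dots> = ennreal t + ennreal (4 * C) * (ennreal \<alpha> + ennreal \<beta>)"
      using that C(3) by (simp add: ennreal_mult)
    finally show ?thesis .
  qed
  \<comment> \<open>The factors come from \<open>nn_avg_lower_cyl_le\<close> with \<open>K = 4 C\<close> and from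
    \<open>nn_avg_cyl_le_ball\<close>.\<close>
  define M :: ennreal where "M = 2 * ennreal (4 * C) * 2 ^ DIM('a)"
  have M: "M < \<infinity>"
    unfolding M_def by (auto simp: ennreal_mult_less_top power_less_top_ennreal)
  have error: "((\<lambda>\<tau>. M * nn_avg (ball x0 (2 * \<tau>)) ?h) \<longlongrightarrow> 0) (at_right 0)"
    by (rule tendsto_cmult_nn_avg_double[OF lim M])
  have cyl_le: "2 * ennreal (4 * C) * nn_avg (cyl x0 \<nu> \<tau>) ?h \<le> M * nn_avg (ball x0 (2 * \<tau>)) ?h"
    if "norm \<nu> = 1" "0 < \<tau>" for \<nu> \<tau>
    unfolding M_def mult.assoc using that by (intro mult_left_mono nn_avg_cyl_le_ball) auto
  have h_meas: "?h \<in> borel_measurable (lebesgue_on (ball x0 (2 * \<tau>)))" if "ball x0 (2 * \<tau>) \<subseteq> \<Omega>" for \<tau>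
  proof -
    have [measurable]: "f \<in> borel_measurable (lebesgue_on (ball x0 (2 * \<tau>)))"
      by (rule measurable_restrict_mono[OF f_meas that])
    show ?thesis by measurable
  qed
  have const: "nn_avg (lower_cyl x0 \<nu> \<tau>) (\<lambda>_. ?D2) = ?D2" if "norm \<nu> = 1" "0 < \<tau>" for \<nu> \<tau>
    by (intro nn_avg_const sets_cyl emeasure_lower_cyl_pos_finite that)
  note small = eventually_double_ball_subset[OF assms(1,2) R(1)]

  show "jdir f \<nu> x0 \<le> ennreal (norm (a - b))" if \<nu>: "norm \<nu> = 1"
  proof -
    have "\<forall>\<^sub>F \<tau> in at_right 0. nn_avg (lower_cyl x0 \<nu> \<tau>) (?u \<nu> \<tau>)
        \<le> ?D2 + M * nn_avg (ball x0 (2 * \<tau>)) ?h"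
      using small
    proof eventually_elim
      case (elim \<tau>)
      then have \<tau>: "0 < \<tau>" "2 * \<tau> \<le> R" "ball x0 (2 * \<tau>) \<subseteq> \<Omega>" by auto
      have "nn_avg (lower_cyl x0 \<nu> \<tau>) (?u \<nu> \<tau>)
          \<le> nn_avg (lower_cyl x0 \<nu> \<tau>) (\<lambda>_. ?D2) + 2 * ennreal (4 * C) * nn_avg (cyl x0 \<nu> \<tau>) ?h"
      proof (rule nn_avg_lower_cyl_le[OF \<nu> \<tau>(1) h_meas[OF \<tau>(3)]])
        show "AE z in lebesgue. z \<in> lower_cyl x0 \<nu> \<tau> \<longrightarrow>
            ?u \<nu> \<tau> z \<le> ?D2 + ennreal (4 * C) * (?h (z + \<tau> *\<^sub>R \<nu>) + ?h z)"
          using bound[OF \<nu> \<tau>(2)]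
        proof eventually_elim
          case (elim z)
          have "(norm (?w (z + \<tau> *\<^sub>R \<nu>) - ?w z))\<^sup>2 \<le> (norm (a - b))\<^sup>2"
            by (intro power_mono norm_two_phase_diff_le) auto
          with elim have "(norm (f (z + \<tau> *\<^sub>R \<nu>) - f z))\<^sup>2 \<le> (norm (a - b))\<^sup>2
              + 4 * C * (norm (f (z + \<tau> *\<^sub>R \<nu>) - ?w (z + \<tau> *\<^sub>R \<nu>)) + norm (f z - ?w z))"
            if "z \<in> lower_cyl x0 \<nu> \<tau>"
            using that by linarith
          then show ?case by (intro impI enn_le) auto
        qed
      qed simp
      also have "\<dots> \<le> ?D2 + M * nn_avg (ball x0 (2 * \<tau>)) ?h"
        unfolding const[OF \<nu> \<tau>(1)] by (intro add_left_mono cyl_le \<nu> \<tau>)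
      finally show ?case .
    qed
    then have "Limsup (at_right 0) (\<lambda>\<tau>. nn_avg (lower_cyl x0 \<nu> \<tau>) (?u \<nu> \<tau>))
        \<le> Limsup (at_right 0) (\<lambda>\<tau>. ?D2 + M * nn_avg (ball x0 (2 * \<tau>)) ?h)"
      by (rule Limsup_mono)
    also have "\<dots> = ?D2"
      using tendsto_add[OF tendsto_const[of ?D2] error] by (intro lim_imp_Limsup) auto
    finally show ?thesis unfolding jdir_def ennsqrt_le_iff by (simp add: ennreal_power)
  qed

  show "ennreal (norm (a - b)) \<le> jdir f \<mu> x0" if \<mu>: "norm \<mu> = 1"
  proof -
    have "\<forall>\<^sub>F \<tau> in at_right 0. ?D2 - M * nn_avg (ball x0 (2 * \<tau>)) ?h
        \<le> nn_avg (lower_cyl x0 \<mu> \<tau>) (?u \<mu> \<tau>)"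
      using small
    proof eventually_elim
      case (elim \<tau>)
      then have \<tau>: "0 < \<tau>" "2 * \<tau> \<le> R" "ball x0 (2 * \<tau>) \<subseteq> \<Omega>" by auto
      have "(\<lambda>z. z + \<tau> *\<^sub>R \<mu>) \<in> lebesgue_on (lower_cyl x0 \<mu> \<tau>) \<rightarrow>\<^sub>M lebesgue_on \<Omega>"
        by (intro measurable_restrict_space3 lebesgue_measurable_shift)
          (use shift_lower_cyl_subset_ball[OF \<mu>] \<tau>(3) in blast)
      from measurable_compose[OF this f_meas]
      have [measurable]: "(\<lambda>z. f (z + \<tau> *\<^sub>R \<mu>)) \<in> borel_measurable (lebesgue_on (lower_cyl x0 \<mu> \<tau>))" .
      have [measurable]: "f \<in> borel_measurable (lebesgue_on (lower_cyl x0 \<mu> \<tau>))"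
        using lower_cyl_subset_cyl[of x0 \<mu> \<tau>] cyl_subset_ball[OF \<mu>, of x0 \<tau>] \<tau>(3)
        by (intro measurable_restrict_mono[OF f_meas]) blast
      have "?D2 = nn_avg (lower_cyl x0 \<mu> \<tau>) (\<lambda>_. ?D2)" by (rule const[OF \<mu> \<tau>(1), symmetric])
      also have "\<dots> \<le> nn_avg (lower_cyl x0 \<mu> \<tau>) (?u \<mu> \<tau>) + 2 * ennreal (4 * C) * nn_avg (cyl x0 \<mu> \<tau>) ?h"
      proof (rule nn_avg_lower_cyl_le[OF \<mu> \<tau>(1) h_meas[OF \<tau>(3)]])
        show "AE z in lebesgue. z \<in> lower_cyl x0 \<mu> \<tau> \<longrightarrow>
            ?D2 \<le> ?u \<mu> \<tau> z + ennreal (4 * C) * (?h (z + \<tau> *\<^sub>R \<mu>) + ?h z)"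
          using bound[OF \<mu> \<tau>(2)]
        proof eventually_elim
          case (elim z)
          show ?case
          proof
            assume z: "z \<in> lower_cyl x0 \<mu> \<tau>"
            have "norm (?w (z + \<tau> *\<^sub>R \<mu>) - ?w z) = norm (a - b)"
              by (simp add: two_phase_shift[OF \<mu> z])
            with elim z show "?D2 \<le> ?u \<mu> \<tau> z + ennreal (4 * C) * (?h (z + \<tau> *\<^sub>R \<mu>) + ?h z)"
              by (intro enn_le) auto
          qed
        qed
      qed measurable
      also have "\<dots> \<le> nn_avg (lower_cyl x0 \<mu> \<tau>) (?u \<mu> \<tau>) + M * nn_avg (ball x0 (2 * \<tau>)) ?h"
        by (intro add_left_mono cyl_le \<mu> \<tau>)
      finally show ?case by (simp add: ennreal_minus_le_iff add.commute)
    qed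
    then have "Limsup (at_right 0) (\<lambda>\<tau>. ?D2 - M * nn_avg (ball x0 (2 * \<tau>)) ?h)
        \<le> Limsup (at_right 0) (\<lambda>\<tau>. nn_avg (lower_cyl x0 \<mu> \<tau>) (?u \<mu> \<tau>))"
      by (rule Limsup_mono)
    moreover have "Limsup (at_right 0) (\<lambda>\<tau>. ?D2 - M * nn_avg (ball x0 (2 * \<tau>)) ?h) = ?D2"
      using tendsto_diff_ennreal[OF tendsto_const[of ?D2] error] by (intro lim_imp_Limsup) auto
    ultimately show ?thesis unfolding jdir_def le_ennsqrt_iff by (simp add: ennreal_power)
  qed
qed

lemma jump_triple_two_phase:
  fixes f :: "'a::euclidean_space \<Rightarrow> 'b::euclidean_space"
  assumes "open \<Omega>" "x0 \<in> \<Omega>" and f: "f \<in> borel_measurable (lebesgue_on \<Omega>)"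
    and jump: "jump_triple f x0 fp fm \<nu>"
  shows "((\<lambda>r. nn_avg (ball x0 r) (\<lambda>y. ennreal (norm (f y - two_phase x0 \<nu> fp fm y)))) \<longlongrightarrow> 0) (at_right 0)"
proof (rule tendsto_sandwich[OF _ _ tendsto_const])
  show "\<forall>\<^sub>F r in at_right 0. nn_avg (ball x0 r) (\<lambda>y. ennreal (norm (f y - two_phase x0 \<nu> fp fm y)))
      \<le> nn_avg (half_ball x0 \<nu> r) (\<lambda>y. ennreal (norm (f y - fp)))
        + nn_avg (half_ball x0 (-\<nu>) r) (\<lambda>y. ennreal (norm (f y - fm)))"
    using eventually_double_ball_subset[OF assms(1,2) zero_less_one]
  proof eventually_elim
    case (elim r)
    then have "ball x0 r \<subseteq> \<Omega>" using subset_ball[of r "2 * r" x0] by auto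
    then show ?case by (intro nn_avg_ball_two_phase_le measurable_restrict_mono[OF f])
  qed
  show "((\<lambda>r. nn_avg (half_ball x0 \<nu> r) (\<lambda>y. ennreal (norm (f y - fp)))
      + nn_avg (half_ball x0 (-\<nu>) r) (\<lambda>y. ennreal (norm (f y - fm)))) \<longlongrightarrow> 0) (at_right 0)"
    using jump tendsto_add[of _ "0::ennreal" "at_right (0::real)" _ 0] unfolding jump_triple_def by auto
qed simp

section \<open>The jump function on jump points and Lebesgue points\<close>

theorem proposition7p1:
  fixes \<Omega> :: "(real ^ 'm) set" and f :: "real ^ 'm \<Rightarrow> real ^ 'n"
  assumes "open \<Omega>" and "f \<in> L2_loc \<Omega>"
  shows "(\<forall>x0\<in>\<Omega>. \<forall>\<nu>0\<in>sphere 0 1.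
           (jdir f \<nu>0 x0)\<^sup>2 \<le> 4 * Limsup (at_right 0)
             (\<lambda>\<tau>. nn_avg (cyl x0 \<nu>0 \<tau>)
                (\<lambda>x. ennreal ((norm (f x - avg (cyl x0 \<nu>0 \<tau>) f))\<^sup>2)))) \<and>
         (\<forall>x0\<in>\<Omega>. Lebesgue_point2 f x0 \<longrightarrow> jsup f x0 = 0) \<and>
         (f \<in> Linf_loc \<Omega> \<longrightarrow>
           J_set \<Omega> f \<subseteq> J_tilde \<Omega> f \<and> J_tilde \<Omega> f \<subseteq> S_set \<Omega> f \<and>
           (\<forall>x0\<in>J_set \<Omega> f. \<forall>fp fm \<nu>f. jump_triple f x0 fp fm \<nu>f \<longrightarrow>
              jsup f x0 = jdir f \<nu>f x0 \<and> jdir f \<nu>f x0 = ennreal (norm (fp - fm))))"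
proof (intro conjI impI ballI allI)
  have f: "f \<in> borel_measurable (lebesgue_on \<Omega>)" using assms(2) by (simp add: L2_loc_def)
  show "(jdir f \<nu>0 x0)\<^sup>2 \<le> 4 * Limsup (at_right 0)
      (\<lambda>\<tau>. nn_avg (cyl x0 \<nu>0 \<tau>) (\<lambda>x. ennreal ((norm (f x - avg (cyl x0 \<nu>0 \<tau>) f))\<^sup>2)))"
    if "x0 \<in> \<Omega>" "\<nu>0 \<in> sphere 0 1" for x0 \<nu>0
    using that by (intro jdir_squared_le_oscillation[OF assms(1) _ f]) auto
  show "jsup f x0 = 0" if "x0 \<in> \<Omega>" "Lebesgue_point2 f x0" for x0
    using jdir_eq_0_if_L2_average_tendsto_0[OF assms(1) that(1) f] that(2)
    unfolding Lebesgue_point2_def jsup_def by (auto simp: SUP_eq_iff)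
  assume Linf: "f \<in> Linf_loc \<Omega>"
  have jump: "jdir f \<nu>f x0 = ennreal (norm (fp - fm)) \<and> jsup f x0 = jdir f \<nu>f x0"
    if "x0 \<in> \<Omega>" "jump_triple f x0 fp fm \<nu>f" for x0 fp fm \<nu>f
  proof -
    have \<nu>: "norm \<nu>f = 1" using that(2) by (simp add: jump_triple_def)
    note lim = jump_triple_two_phase[OF assms(1) that(1) f that(2)]
    have le: "jdir f \<nu> x0 \<le> ennreal (norm (fp - fm))" if "norm \<nu> = 1" for \<nu>
      by (rule jdir_le_two_phase[OF assms(1) \<open>x0 \<in> \<Omega>\<close> Linf lim that])
    have eq: "jdir f \<nu>f x0 = ennreal (norm (fp - fm))"
      using le[OF \<nu>] jdir_ge_two_phase[OF assms(1) that(1) Linf lim \<nu>] by (rule antisym)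
    moreover have "jsup f x0 = jdir f \<nu>f x0"
      unfolding jsup_def eq
    proof (rule antisym)
      show "(SUP \<nu>\<in>sphere 0 1. jdir f \<nu> x0) \<le> ennreal (norm (fp - fm))"
        by (rule SUP_least) (simp add: le)
      show "ennreal (norm (fp - fm)) \<le> (SUP \<nu>\<in>sphere 0 1. jdir f \<nu> x0)"
        unfolding eq[symmetric] by (rule SUP_upper) (simp add: \<nu>)
    qed
    ultimately show ?thesis by simp
  qed
  show "jsup f x0 = jdir f \<nu>f x0" "jdir f \<nu>f x0 = ennreal (norm (fp - fm))"
    if "x0 \<in> J_set \<Omega> f" "jump_triple f x0 fp fm \<nu>f" for x0 fp fm \<nu>f
    using jump[OF _ that(2)] that(1) by (auto simp: J_set_def)
  show "J_set \<Omega> f \<subseteq> J_tilde \<Omega> f"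
  proof
    fix x0 assume "x0 \<in> J_set \<Omega> f"
    then obtain fp fm \<nu> where "x0 \<in> \<Omega>" and t: "jump_triple f x0 fp fm \<nu>" by (auto simp: J_set_def)
    moreover have "fp \<noteq> fm" using t by (simp add: jump_triple_def)
    ultimately show "x0 \<in> J_tilde \<Omega> f" using jump[OF _ t] by (simp add: J_tilde_def)
  qed
  show "J_tilde \<Omega> f \<subseteq> S_set \<Omega> f"
  proof (rule subsetI, rule ccontr)
    fix x0 assume x0: "x0 \<in> J_tilde \<Omega> f" "x0 \<notin> S_set \<Omega> f"
    then have \<Omega>: "x0 \<in> \<Omega>" by (simp add: J_tilde_def)
    then obtain z where "((\<lambda>r. nn_avg (ball x0 r) (\<lambda>y. ennreal (norm (f y - z)))) \<longlongrightarrow> 0) (at_right 0)"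
      using x0(2) by (auto simp: S_set_def)
    \<comment> \<open>A Lebesgue value \<open>z\<close> is a two-phase comparison with no jump.\<close>
    then have "((\<lambda>r. nn_avg (ball x0 r) (\<lambda>y. ennreal (norm (f y - two_phase x0 0 z z y)))) \<longlongrightarrow> 0) (at_right 0)"
      by (simp add: two_phase_def)
    from jdir_le_two_phase[OF assms(1) \<Omega> Linf this]
    have "jsup f x0 \<le> 0" unfolding jsup_def by (intro SUP_least) simp
    with x0(1) show False by (simp add: J_tilde_def)
  qed
qed

end
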